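(* For $\max\{|ac|,|ad|,|asz|,|abcds|\}<1$, $$\sum_{n=0}^\infty\frac{s^n(s^{-1};q)_n}{(abcds;q)_n}A_n(a,b)H_n(z)=\frac{(abcd,acs,ads,az;q)_\infty}{(abcds,ac,ad,asz;q)_\infty},$$ where $H_n(z)=H_n(a,b,c,d;z)$ are the $q$-Hahn polynomials $$H_n(a,b,c,d;z)=\frac{(ac,ad;q)_n}{a^n}\,{}_3\phi_2\left({{q^{-n},\,abcdq^{n-1},\,az}\atop{ac,\ ad}};q,q\right)$$ and $$A_n(a,b)=\frac{(1-abcdq^{2n-1})(abcdq^{-1};q)_n\,a^n}{(1-abcdq^{-1})(q,ac,ad;q)_n}.$$
   Context: Here $q$ is a nonzero complex number with $|q|<1$, and $a,b,c,d,s,z$ are complex numbers such that no zero factors occur in denominators. Notation: $(x;q)_0=1$, $(x;q)_n=\prod_{k=0}^{n-1}(1-xq^k)$ for $n=1,2,\dots$ or $n=\infty$, and $(x_1,\dots,x_r;q)_n=(x_1;q)_n\cdots(x_r;q)_n$. The basic hypergeometric series is $${}_3\phi_2\left({{a_1,a_2,a_3}\atop{b_1,b_2}};q,z\right)=\sum_{k=0}^\infty\frac{(a_1,a_2,a_3;q)_k}{(q,b_1,b_2;q)_k}z^k.$$ *)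

theory Defs
  imports "HOL-Analysis.Analysis"
begin

definition qpoch :: "complex \<Rightarrow> complex \<Rightarrow> nat \<Rightarrow> complex" where
  "qpoch x q n = (\<Prod>k<n. 1 - x * q ^ k)"

text \<open>
  For \<open>norm q < 1\<close> the infinite product converges in the sense of \<open>has_prod\<close>, which allows finitely
  many zero factors (the value is then \<open>0\<close>).
\<close>

definition qpoch_inf :: "complex \<Rightarrow> complex \<Rightarrow> complex" where
  "qpoch_inf x q = (\<Prod>k. 1 - x * q ^ k)"

definition qpochs :: "complex list \<Rightarrow> complex \<Rightarrow> nat \<Rightarrow> complex" where
  "qpochs xs q n = (\<Prod>x\<leftarrow>xs. qpoch x q n)"

definition qpochs_inf :: "complex list \<Rightarrow> complex \<Rightarrow> complex" where
  "qpochs_inf xs q = (\<Prod>x\<leftarrow>xs. qpoch_inf x q)"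

definition phi32 ::
  "complex \<Rightarrow> complex \<Rightarrow> complex \<Rightarrow> complex \<Rightarrow> complex \<Rightarrow> complex \<Rightarrow> complex \<Rightarrow> complex" where
  "phi32 a1 a2 a3 b1 b2 q z =
     (\<Sum>k. qpochs [a1, a2, a3] q k / qpochs [q, b1, b2] q k * z ^ k)"

text \<open>
  Integer exponents (\<open>powi\<close>) are used because \<open>n - 1\<close> and \<open>2 * n - 1\<close> are negative for \<open>n = 0\<close>.
  \<open>qHahn_coeff\<close> is the factor \<open>A\<^sub>n(a, b)\<close>, whose dependence on \<open>c\<close>, \<open>d\<close>, \<open>q\<close> is made explicit.
\<close>

definition qHahn ::
  "complex \<Rightarrow> nat \<Rightarrow> complex \<Rightarrow> complex \<Rightarrow> complex \<Rightarrow> complex \<Rightarrow> complex \<Rightarrow> complex" where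
  "qHahn q n a b c d z =
     qpochs [a * c, a * d] q n / a ^ n *
     phi32 (q powi (- int n)) (a * b * c * d * q powi (int n - 1)) (a * z) (a * c) (a * d) q q"

definition qHahn_coeff ::
  "complex \<Rightarrow> nat \<Rightarrow> complex \<Rightarrow> complex \<Rightarrow> complex \<Rightarrow> complex \<Rightarrow> complex" where
  "qHahn_coeff q n a b c d =
     (1 - a * b * c * d * q powi (2 * int n - 1)) * qpoch (a * b * c * d * inverse q) q n * a ^ n /
     ((1 - a * b * c * d * inverse q) * qpochs [q, a * c, a * d] q n)"

end

theory Submission
  imports Defs "HOL-Complex_Analysis.Conformal_Mappings"
begin

text \<open>
  Put \<open>\<alpha> = a b c d / q\<close>, \<open>d' = a c\<close>, \<open>e' = a d\<close> and \<open>x = a z\<close>. After cancellation the \<open>n\<close>-th summand is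
  \[ \frac{\prod_{j<n} (s - q^j)\,(\alpha;q)_n (1 - \alpha q^{2n})}
          {(\alpha q s, q;q)_n (1 - \alpha)}\; F_n, \qquad
     F_n = {}_3\phi_2(q^{-n}, \alpha q^n, x; d', e'; q, q), \]
  so that it is a rational function of \<open>s\<close> which is regular at \<open>s = 0\<close>. The identity is first proved
  at the points \<open>s = q^N\<close> and then extended by the identity theorem for holomorphic functions, since
  these points accumulate at \<open>0\<close>. Interchanging the two summations directly for general \<open>s\<close> is not
  possible: the resulting inner series over \<open>n\<close> have ratio tending to \<open>s q^{-k}\<close> and diverge for
  large \<open>k\<close>.

  At \<open>s = q^N\<close> the series terminates, so the interchange is harmless. For each \<open>k\<close> the inner sum over
  \<open>n\<close>, multiplied by \<open>s - q^k\<close>, telescopes (\<open>sum_node_qpoch_telescope\<close>) to a multiple of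
  \<open>\<Prod>j\<le>N. s - q^j\<close>, which vanishes at \<open>s = q^N\<close>. Hence only \<open>k = N\<close> survives, and this single
  term is the right-hand side (\<open>qHahn_term_sums_power\<close>).

  The identity theorem needs the series to converge locally uniformly in \<open>s\<close> on a disc containing
  the given \<open>s\<close>. As \<open>\<Prod>j<n. s - q^j\<close> is \<open>O(\<bar>s\<bar>^n)\<close> and \<open>\<bar>s x\<bar> < 1\<close>, it suffices that
  \<open>F_n = O(R^n)\<close> for every \<open>R > \<bar>x\<bar>\<close>. The defining sum of \<open>F_n\<close> does not show this, because its terms
  can reach a size of about \<open>\<bar>q\<bar>^{-n^2/2}\<close> and cancel. The rearrangement in \<open>phi32_poly_convolution\<close>
  has no large terms and gives the bound (\<open>phi32_poly_growth\<close>).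
\<close>

section \<open>Finite q-shifted factorials\<close>

lemma qpoch_0 [simp]: "qpoch x q 0 = 1"
  by (simp add: qpoch_def)

lemma qpoch_Suc: "qpoch x q (Suc n) = qpoch x q n * (1 - x * q ^ n)"
  by (simp add: qpoch_def)

lemma qpoch_add: "qpoch x q (m + n) = qpoch x q m * qpoch (x * q ^ m) q n"
  by (induction n) (simp_all add: qpoch_Suc power_add mult.assoc)

lemma qpoch_Suc_left: "qpoch x q (Suc n) = (1 - x) * qpoch (x * q) q n"
  using qpoch_add[of x q 1 n] by (simp add: qpoch_Suc)

lemma qpoch_eq_0_iff: "qpoch x q n = 0 \<longleftrightarrow> (\<exists>k<n. x * q ^ k = 1)"
  by (auto simp: qpoch_def)

lemma mult_power_neq_1:
  fixes x q :: complex
  assumes "norm q < 1" "norm x < 1"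
  shows "x * q ^ k \<noteq> 1"
proof
  assume "x * q ^ k = 1"
  moreover have "norm (x * q ^ k) \<le> norm x * 1"
    unfolding norm_mult norm_power using assms by (intro mult_left_mono power_le_one) auto
  ultimately show False using assms by simp
qed

lemma qpoch_nonzero: "norm q < 1 \<Longrightarrow> norm x < 1 \<Longrightarrow> qpoch x q n \<noteq> 0"
  using mult_power_neq_1 by (auto simp: qpoch_eq_0_iff)

lemma qpoch_inverse_power_eq_0:
  assumes "q \<noteq> 0" "n < k"
  shows "qpoch (inverse q ^ n) q k = 0"
  unfolding qpoch_eq_0_iff
  by (rule exI[of _ n]) (use assms in \<open>simp add: power_inverse\<close>)

section \<open>Bounds for products that are uniform in the number of factors\<close>

lemma prod_one_plus_geometric_le:
  fixes c r :: real
  assumes "0 \<le> c" "0 \<le> r" "r < 1"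
  shows "(\<Prod>k<n. 1 + c * r ^ k) \<le> exp (c / (1 - r))"
proof -
  have "(\<Prod>k<n. 1 + c * r ^ k) \<le> (\<Prod>k<n. exp (c * r ^ k))"
    using assms by (intro prod_mono) (auto intro: add_nonneg_nonneg)
  also have "\<dots> = exp (c * (\<Sum>k<n. r ^ k))"
    by (simp add: exp_sum sum_distrib_left)
  also have "(\<Sum>k<n. r ^ k) \<le> 1 / (1 - r)"
    using assms by (simp add: sum_gp_strict divide_right_mono)
  finally show ?thesis
    using assms by (simp add: mult_left_mono)
qed

lemma prod_plus_geometric_le:
  fixes c r A :: real
  assumes "0 < A" "0 \<le> c" "0 \<le> r" "r < 1"
  shows "(\<Prod>k<n. A + c * r ^ k) \<le> A ^ n * exp (c / A / (1 - r))"
proof -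
  have "(\<Prod>k<n. A + c * r ^ k) = (\<Prod>k<n. A * (1 + c / A * r ^ k))"
    using assms by (simp add: distrib_left)
  also have "\<dots> = A ^ n * (\<Prod>k<n. 1 + c / A * r ^ k)"
    by (simp add: prod.distrib)
  also have "\<dots> \<le> A ^ n * exp (c / A / (1 - r))"
    using assms by (intro mult_left_mono prod_one_plus_geometric_le) auto
  finally show ?thesis .
qed

lemma norm_qpoch_le:
  assumes "norm q < 1"
  shows "norm (qpoch x q n) \<le> exp (norm x / (1 - norm q))"
proof -
  have "norm (qpoch x q n) \<le> (\<Prod>k<n. 1 + norm x * norm q ^ k)"
    unfolding qpoch_def prod_norm[symmetric]
    by (intro prod_mono)
       (auto simp: norm_mult norm_power intro: order.trans[OF norm_triangle_ineq4])
  also have "\<dots> \<le> exp (norm x / (1 - norm q))"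
    using assms by (intro prod_one_plus_geometric_le) auto
  finally show ?thesis .
qed

text \<open>
  Since \<open>1 / (1 - u) = 1 + u / (1 - u)\<close>, the reciprocal factors are again of the form one plus a
  geometrically decaying term. The bound depends on \<open>x\<close> only through \<open>t\<close>, which makes it usable for
  convergence that is uniform in a parameter.
\<close>

lemma norm_inverse_qpoch_le:
  assumes "norm q < 1" "norm x \<le> t" "t < 1"
  shows "norm (inverse (qpoch x q n)) \<le> exp (t / (1 - t) / (1 - norm q))"
proof -
  have t: "0 \<le> t" using assms(2) norm_ge_zero order.trans by blast
  have "norm (inverse (1 - x * q ^ k)) \<le> 1 + t / (1 - t) * norm q ^ k" for k
  proof -
    define u where "u = t * norm q ^ k"
    have q1: "norm q ^ k \<le> 1" using assms by (simp add: power_le_one)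
    have u: "0 \<le> u" "u \<le> t"
      using t q1 unfolding u_def by (auto simp: mult_left_le)
    have "norm (x * q ^ k) \<le> u"
      unfolding u_def norm_mult norm_power using assms by (intro mult_right_mono) auto
    then have "1 - u \<le> norm (1 - x * q ^ k)"
      using norm_triangle_ineq2[of 1 "x * q ^ k"] by simp
    then have "norm (inverse (1 - x * q ^ k)) \<le> inverse (1 - u)"
      unfolding norm_inverse using u assms by (intro le_imp_inverse_le) auto
    also have "\<dots> = 1 + u / (1 - u)"
      using u assms by (simp add: field_simps)
    also have "\<dots> \<le> 1 + u / (1 - t)"
      using u assms by (intro add_left_mono divide_left_mono mult_pos_pos) auto
    finally show ?thesis by (simp add: u_def)
  qed
  then have "norm (inverse (qpoch x q n)) \<le> (\<Prod>k<n. 1 + t / (1 - t) * norm q ^ k)"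
    unfolding qpoch_def prod_inversef[symmetric] o_def prod_norm[symmetric]
    by (intro prod_mono) auto
  also have "\<dots> \<le> exp (t / (1 - t) / (1 - norm q))"
    using assms t by (intro prod_one_plus_geometric_le) auto
  finally show ?thesis .
qed

text \<open>
  A perturbation of the factors that decays geometrically costs only a constant: the product
  grows at most like \<open>A ^ n\<close>. Any positive \<open>A\<close>, however small, is allowed.
\<close>

lemma norm_prod_le_power:
  fixes u :: "nat \<Rightarrow> complex"
  assumes "norm q < 1" "0 < A" "0 \<le> c" "\<And>j. j < n \<Longrightarrow> norm (u j) \<le> A + c * norm q ^ j"
  shows "norm (\<Prod>j<n. u j) \<le> A ^ n * exp (c / A / (1 - norm q))"
proof -
  have "norm (\<Prod>j<n. u j) \<le> (\<Prod>j<n. A + c * norm q ^ j)"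
    unfolding prod_norm[symmetric] using assms(4) by (intro prod_mono) auto
  also have "\<dots> \<le> A ^ n * exp (c / A / (1 - norm q))"
    using assms by (intro prod_plus_geometric_le) auto
  finally show ?thesis .
qed

section \<open>The terminating series and its rearrangement\<close>

definition qbinom :: "complex \<Rightarrow> nat \<Rightarrow> nat \<Rightarrow> complex" where
  "qbinom q n k = (if k \<le> n then qpoch q q n / (qpoch q q k * qpoch q q (n - k)) else 0)"

lemma qbinom_0: "norm q < 1 \<Longrightarrow> qbinom q n 0 = 1"
  using qpoch_nonzero[of q q n] by (simp add: qbinom_def)

lemma qbinom_Suc_Suc:
  assumes q: "norm q < 1"
  shows "qbinom q (Suc n) (Suc k) = q ^ Suc k * qbinom q n (Suc k) + qbinom q n k"
proof -
  have nz: "qpoch q q m \<noteq> 0" for m using qpoch_nonzero q by blast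
  have nz1: "1 - q * q ^ m \<noteq> 0" for m using mult_power_neq_1[of q q m] q by simp
  consider "k > n" | "k = n" | m where "n = Suc (k + m)"
    by (metis less_imp_Suc_add linorder_neqE_nat)
  then show ?thesis
  proof cases
    case 3
    have d: "Suc n - Suc k = Suc m" "n - Suc k = m" "n - k = Suc m" using 3 by auto
    have le: "Suc k \<le> Suc n" "Suc k \<le> n" "k \<le> n" using 3 by auto
    have p: "q ^ n = q * q ^ k * q ^ m" using 3 by (simp add: power_add)
    show ?thesis
      unfolding qbinom_def d using le nz nz1
      by (simp add: qpoch_Suc p divide_simps) (simp add: algebra_simps)
  qed (use nz in \<open>auto simp: qbinom_def\<close>)
qed

text \<open>
  The \<open>q\<close>-Pascal rule in summed form, which is how it enters inductions on \<open>n\<close>.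
\<close>

lemma sum_qbinom_Suc:
  assumes "norm q < 1"
  shows "(\<Sum>k\<le>Suc n. qbinom q (Suc n) k * f k) =
         (\<Sum>k\<le>n. qbinom q n k * (q ^ k * f k + f (Suc k)))"
proof -
  have "(\<Sum>k\<le>Suc n. qbinom q (Suc n) k * f k) =
        f 0 + (\<Sum>k\<le>n. (q ^ Suc k * qbinom q n (Suc k) + qbinom q n k) * f (Suc k))"
    using assms by (simp only: sum.atMost_Suc_shift qbinom_Suc_Suc qbinom_0) simp
  also have "\<dots> = (f 0 + (\<Sum>k\<le>n. q ^ Suc k * qbinom q n (Suc k) * f (Suc k)))
                  + (\<Sum>k\<le>n. qbinom q n k * f (Suc k))"
    by (simp add: algebra_simps sum.distrib)
  also have "f 0 + (\<Sum>k\<le>n. q ^ Suc k * qbinom q n (Suc k) * f (Suc k)) =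
             (\<Sum>k\<le>Suc n. q ^ k * qbinom q n k * f k)"
    using assms by (simp only: sum.atMost_Suc_shift qbinom_0) simp
  also have "\<dots> = (\<Sum>k\<le>n. q ^ k * qbinom q n k * f k)"
    by (simp add: qbinom_def)
  finally show ?thesis
    by (simp add: algebra_simps sum.distrib)
qed

text \<open>
  The terminating series \<open>\<^sub>3\<phi>\<^sub>2(q^{-n}, \<beta>, x; d, e; q, q)\<close>. The parameter \<open>\<beta>\<close> is kept independent of \<open>n\<close>,
  because the recurrence below lowers \<open>n\<close> at fixed \<open>\<beta>\<close>.
\<close>

definition phi32_poly ::
  "complex \<Rightarrow> nat \<Rightarrow> complex \<Rightarrow> complex \<Rightarrow> complex \<Rightarrow> complex \<Rightarrow> complex" where
  "phi32_poly q n \<beta> x d e =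
     (\<Sum>k\<le>n. qpoch (inverse q ^ n) q k * qpoch \<beta> q k * qpoch x q k /
             (qpoch q q k * qpoch d q k * qpoch e q k) * q ^ k)"

lemma phi32_poly_upto:
  assumes "q \<noteq> 0" "n \<le> m"
  shows "phi32_poly q n \<beta> x d e =
     (\<Sum>k\<le>m. qpoch (inverse q ^ n) q k * qpoch \<beta> q k * qpoch x q k /
             (qpoch q q k * qpoch d q k * qpoch e q k) * q ^ k)"
  unfolding phi32_poly_def
  by (rule sum.mono_neutral_left) (use assms in \<open>auto simp: qpoch_inverse_power_eq_0\<close>)

lemma phi32_eq_phi32_poly:
  assumes "q \<noteq> 0"
  shows "phi32 (q powi (- int n)) \<beta> x d e q q = phi32_poly q n \<beta> x d e"
proof -
  have "q powi (- int n) = inverse q ^ n"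
    by (simp add: power_int_def power_inverse)
  then show ?thesis
    unfolding phi32_def qpochs_def phi32_poly_def
    using assms
    by (subst suminf_finite[of "{..n}"]) (auto simp: qpoch_inverse_power_eq_0 mult.assoc)
qed

text \<open>
  A contiguous relation: the factors \<open>(q^{-n-1};q)\<^sub>k\<close> and \<open>(q^{-n};q)\<^sub>k\<close> share \<open>k - 1\<close> linear factors,
  and their difference contains \<open>1 - q^k\<close>, which cancels against \<open>(q;q)\<^sub>k\<close> and shifts the summation
  index by one.
\<close>

lemma phi32_poly_Suc:
  assumes "q \<noteq> 0" "norm q < 1"
  shows "phi32_poly q (Suc n) \<beta> x d e = phi32_poly q n \<beta> x d e -
           inverse q ^ n * (1 - \<beta>) * (1 - x) / ((1 - d) * (1 - e)) *
           phi32_poly q n (\<beta> * q) (x * q) (d * q) (e * q)"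
proof -
  define c where "c k = qpoch \<beta> q k * qpoch x q k /
             (qpoch q q k * qpoch d q k * qpoch e q k) * q ^ k" for k
  have nz1: "1 - q * q ^ m \<noteq> 0" for m using mult_power_neq_1[of q q m] assms by simp
  have diff: "qpoch (inverse q ^ Suc n) q (Suc k) - qpoch (inverse q ^ n) q (Suc k) =
              - (inverse q ^ Suc n) * (1 - q * q ^ k) * qpoch (inverse q ^ n) q k" for k
  proof -
    define a where "a = inverse q ^ Suc n"
    have b: "inverse q ^ n = a * q" using assms by (simp add: a_def)
    show ?thesis
      unfolding a_def[symmetric] b qpoch_Suc_left[of a] qpoch_Suc[of "a * q"]
      by (simp add: algebra_simps)
  qed
  have "phi32_poly q m \<beta> x d e = (\<Sum>k\<le>Suc n. qpoch (inverse q ^ m) q k * c k)"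
    if "m \<le> Suc n" for m
    unfolding phi32_poly_upto[OF assms(1) that] c_def by (simp only: times_divide_eq_left times_divide_eq_right mult.assoc)
  then have "phi32_poly q (Suc n) \<beta> x d e - phi32_poly q n \<beta> x d e =
        (\<Sum>k\<le>Suc n. (qpoch (inverse q ^ Suc n) q k - qpoch (inverse q ^ n) q k) * c k)"
    by (simp add: sum_subtractf left_diff_distrib del: sum.atMost_Suc power_Suc)
  also have "\<dots> = (\<Sum>k\<le>n. (qpoch (inverse q ^ Suc n) q (Suc k) - qpoch (inverse q ^ n) q (Suc k))
                      * c (Suc k))"
    by (simp add: sum.atMost_Suc_shift del: sum.atMost_Suc)
  also have "\<dots> = (\<Sum>k\<le>n. - (inverse q ^ n * (1 - \<beta>) * (1 - x) / ((1 - d) * (1 - e))) *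
               (qpoch (inverse q ^ n) q k * qpoch (\<beta> * q) q k * qpoch (x * q) q k /
               (qpoch q q k * qpoch (d * q) q k * qpoch (e * q) q k) * q ^ k))"
  proof (rule sum.cong[OF refl])
    fix k
    have c_Suc: "c (Suc k) * (1 - q * q ^ k) =
            q * ((1 - \<beta>) * (1 - x) / ((1 - d) * (1 - e)) *
              (qpoch (\<beta> * q) q k * qpoch (x * q) q k /
               (qpoch q q k * qpoch (d * q) q k * qpoch (e * q) q k) * q ^ k))"
      unfolding c_def qpoch_Suc[of q q] qpoch_Suc_left[of \<beta>] qpoch_Suc_left[of x]
        qpoch_Suc_left[of d] qpoch_Suc_left[of e]
      using nz1[of k] by (simp add: mult_ac)
    let ?T = "qpoch (\<beta> * q) q k * qpoch (x * q) q k /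
               (qpoch q q k * qpoch (d * q) q k * qpoch (e * q) q k) * q ^ k"
    have "(qpoch (inverse q ^ Suc n) q (Suc k) - qpoch (inverse q ^ n) q (Suc k)) * c (Suc k) =
       - (inverse q ^ Suc n * qpoch (inverse q ^ n) q k * (c (Suc k) * (1 - q * q ^ k)))"
      unfolding diff by (simp only: mult_minus_left mult_minus_right mult_ac)
    also have "\<dots> = - ((inverse q ^ Suc n * q) * qpoch (inverse q ^ n) q k *
       ((1 - \<beta>) * (1 - x) / ((1 - d) * (1 - e)) * ?T))"
      unfolding c_Suc by (simp only: mult_ac)
    also have "inverse q ^ Suc n * q = inverse q ^ n"
      using assms by simp
    finally show "(qpoch (inverse q ^ Suc n) q (Suc k) - qpoch (inverse q ^ n) q (Suc k)) * c (Suc k) =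
       - (inverse q ^ n * (1 - \<beta>) * (1 - x) / ((1 - d) * (1 - e))) *
               (qpoch (inverse q ^ n) q k * qpoch (\<beta> * q) q k * qpoch (x * q) q k /
               (qpoch q q k * qpoch (d * q) q k * qpoch (e * q) q k) * q ^ k)"
      by (simp add: mult_ac)
  qed
  also have "\<dots> = - (inverse q ^ n * (1 - \<beta>) * (1 - x) / ((1 - d) * (1 - e)) *
           phi32_poly q n (\<beta> * q) (x * q) (d * q) (e * q))"
    by (simp add: phi32_poly_def sum_distrib_left sum_negf)
  finally show ?thesis by (simp add: algebra_simps)
qed

text \<open>
  This is one of the transformations of a terminating \<open>\<^sub>3\<phi>\<^sub>2\<close>, written without denominators in \<open>x\<close>.
  On the right all negative powers of \<open>q\<close> have disappeared: for \<open>\<beta> = \<alpha> q^n\<close> the first product is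
  at most \<open>C^k \<bar>q\<bar>^{k(k-1)/2}\<close> with \<open>C = \<bar>\<alpha>\<bar> + \<bar>d\<bar>\<close>, and the last one grows at most
  like \<open>R^{n-k}\<close> for any \<open>R > \<bar>x\<bar>\<close>. Both sides
  satisfy the contiguous relation \<open>phi32_poly_Suc\<close>; for the right-hand side this is the \<open>q\<close>-Pascal
  rule together with
  \<open>(x q^k - e q^n) + (\<beta> - d q^k) (1 - x q^k) / (1 - d q^k) =
   (1 - e q^n) - (1 - \<beta>) (1 - x q^k) / (1 - d q^k)\<close>.
\<close>

theorem phi32_poly_convolution:
  assumes "q \<noteq> 0" "norm q < 1"
    and "\<And>k. d * q ^ k \<noteq> 1" "\<And>k. e * q ^ k \<noteq> 1"
  shows "qpoch e q n * phi32_poly q n \<beta> x d e =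
    (\<Sum>k\<le>n. qbinom q n k * ((\<Prod>j<k. \<beta> - d * q ^ j) * (qpoch x q k / qpoch d q k) *
                              (\<Prod>j<n-k. x - e * q ^ j)))"
  using assms(3,4)
proof (induction n arbitrary: \<beta> x d e)
  case 0
  show ?case by (simp add: phi32_poly_def qbinom_def)
next
  case (Suc n)
  define B where "B k = (\<Prod>j<k. \<beta> - d * q ^ j)" for k
  define X where "X k = qpoch x q k / qpoch d q k" for k
  define E where "E m = (\<Prod>j<m. x - e * q ^ j)" for m
  have d: "1 - d * q ^ k \<noteq> 0" and e: "1 - e * q ^ k \<noteq> 0" for k
    using Suc.prems[of k] by auto
  have e1: "1 - e \<noteq> 0"
    using e[of 0] by simp
  have X_Suc: "X (Suc k) * (1 - d * q ^ k) = X k * (1 - x * q ^ k)" for k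
    unfolding X_def using d[of k] by (simp add: qpoch_Suc)
  have B_Suc: "B (Suc k) = B k * (\<beta> - d * q ^ k)" for k
    by (simp add: B_def)
  have E_Suc: "E (Suc n - k) = E (n - k) * (x - e * q ^ (n - k))" if "k \<le> n" for k
    using that by (simp add: E_def Suc_diff_le)
  have IH: "qpoch e q n * phi32_poly q n \<beta> x d e =
              (\<Sum>k\<le>n. qbinom q n k * (B k * X k * E (n - k)))"
    unfolding B_def X_def E_def by (rule Suc.IH) (use Suc.prems in auto)
  have IH_shifted: "qpoch (e * q) q n * phi32_poly q n (\<beta> * q) (x * q) (d * q) (e * q) *
              (inverse q ^ n * (1 - x) / (1 - d)) =
              (\<Sum>k\<le>n. qbinom q n k * (B k * X (Suc k) * E (n - k)))"
  proof -
    have shift: "d * q * q ^ k \<noteq> 1" "e * q * q ^ k \<noteq> 1" for k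
      using Suc.prems[of "Suc k"] by (auto simp: mult.assoc)
    have B: "(\<Prod>j<k. \<beta> * q - d * q * q ^ j) = q ^ k * B k" for k
    proof -
      have "(\<Prod>j<k. \<beta> * q - d * q * q ^ j) = (\<Prod>j<k. q * (\<beta> - d * q ^ j))"
        by (intro prod.cong) (auto simp: algebra_simps)
      then show ?thesis by (simp add: B_def prod.distrib)
    qed
    have E: "(\<Prod>j<k. x * q - e * q * q ^ j) = q ^ k * E k" for k
    proof -
      have "(\<Prod>j<k. x * q - e * q * q ^ j) = (\<Prod>j<k. q * (x - e * q ^ j))"
        by (intro prod.cong) (auto simp: algebra_simps)
      then show ?thesis by (simp add: E_def prod.distrib)
    qed
    have X: "X (Suc k) = (1 - x) / (1 - d) * (qpoch (x * q) q k / qpoch (d * q) q k)" for k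
      by (simp add: X_def qpoch_Suc_left)
    have q: "q ^ k * q ^ (n - k) * inverse q ^ n = 1" if "k \<le> n" for k
      using that assms(1) by (simp add: power_add[symmetric] power_inverse)
    show ?thesis
      unfolding Suc.IH[OF shift] sum_distrib_right
    proof (rule sum.cong[OF refl])
      fix k assume "k \<in> {..n}"
      then have "k \<le> n" by simp
      let ?Y = "qpoch (x * q) q k / qpoch (d * q) q k"
      have "qbinom q n k * ((q ^ k * B k) * ?Y * (q ^ (n - k) * E (n - k))) *
              (inverse q ^ n * (1 - x) / (1 - d)) =
            (q ^ k * q ^ (n - k) * inverse q ^ n) *
              (qbinom q n k * (B k * ((1 - x) / (1 - d) * ?Y) * E (n - k)))"
        by (simp only: divide_inverse mult_ac)
      then show "qbinom q n k * ((\<Prod>j<k. \<beta> * q - d * q * q ^ j) * ?Y *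
            (\<Prod>j<n-k. x * q - e * q * q ^ j)) * (inverse q ^ n * (1 - x) / (1 - d)) =
          qbinom q n k * (B k * X (Suc k) * E (n - k))"
        unfolding B E X q[OF \<open>k \<le> n\<close>] by simp
    qed
  qed
  have "qpoch e q (Suc n) * phi32_poly q (Suc n) \<beta> x d e =
        (1 - e * q ^ n) * (qpoch e q n * phi32_poly q n \<beta> x d e) -
        (1 - \<beta>) * (qpoch (e * q) q n * phi32_poly q n (\<beta> * q) (x * q) (d * q) (e * q) *
              (inverse q ^ n * (1 - x) / (1 - d)))"
  proof -
    let ?F = "phi32_poly q n \<beta> x d e"
    let ?G = "phi32_poly q n (\<beta> * q) (x * q) (d * q) (e * q)"
    have "qpoch e q (Suc n) * phi32_poly q (Suc n) \<beta> x d e =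
          qpoch e q (Suc n) * ?F - qpoch e q (Suc n) *
            (inverse q ^ n * (1 - \<beta>) * (1 - x) / ((1 - d) * (1 - e)) * ?G)"
      unfolding phi32_poly_Suc[OF assms(1,2)] by (simp only: right_diff_distrib)
    also have "qpoch e q (Suc n) * ?F = (1 - e * q ^ n) * (qpoch e q n * ?F)"
      by (simp add: qpoch_Suc)
    also have "qpoch e q (Suc n) * (inverse q ^ n * (1 - \<beta>) * (1 - x) / ((1 - d) * (1 - e)) * ?G) =
        (1 - \<beta>) * (qpoch (e * q) q n * ?G * (inverse q ^ n * (1 - x) / (1 - d)))"
      unfolding qpoch_Suc_left using e1 by simp
    finally show ?thesis .
  qed
  also have "\<dots> = (\<Sum>k\<le>n. qbinom q n k *
      ((1 - e * q ^ n) * (B k * X k * E (n - k)) - (1 - \<beta>) * (B k * X (Suc k) * E (n - k))))"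
    unfolding IH IH_shifted
    by (simp add: sum_distrib_left sum_subtractf right_diff_distrib mult.left_commute)
  also have "\<dots> = (\<Sum>k\<le>n. qbinom q n k *
      (q ^ k * (B k * X k * E (Suc n - k)) + B (Suc k) * X (Suc k) * E (Suc n - Suc k)))"
  proof (rule sum.cong[OF refl])
    fix k assume "k \<in> {..n}"
    then have k: "k \<le> n" by simp
    have qq: "q ^ k * q ^ (n - k) = q ^ n"
      using k by (simp add: power_add[symmetric])
    have "q ^ k * (B k * X k * E (Suc n - k)) =
          B k * X k * E (n - k) * (x * q ^ k - e * (q ^ k * q ^ (n - k)))"
      unfolding E_Suc[OF k] by (simp add: algebra_simps)
    then have "q ^ k * (B k * X k * E (Suc n - k)) + B (Suc k) * X (Suc k) * E (Suc n - Suc k) =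
          B k * E (n - k) * (X k * (x * q ^ k - e * q ^ n) + (\<beta> - d * q ^ k) * X (Suc k))"
      unfolding B_Suc qq by (simp add: algebra_simps)
    also have "X k * (x * q ^ k - e * q ^ n) + (\<beta> - d * q ^ k) * X (Suc k) =
               X k * (1 - e * q ^ n) - X k * (1 - x * q ^ k) + (\<beta> - d * q ^ k) * X (Suc k)"
      by (simp add: algebra_simps)
    also have "\<dots> = X k * (1 - e * q ^ n) - (1 - \<beta>) * X (Suc k)"
      unfolding X_Suc[symmetric] by (simp add: algebra_simps)
    finally have "(1 - e * q ^ n) * (B k * X k * E (n - k)) - (1 - \<beta>) * (B k * X (Suc k) * E (n - k)) =
        q ^ k * (B k * X k * E (Suc n - k)) + B (Suc k) * X (Suc k) * E (Suc n - Suc k)"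
      by (simp add: algebra_simps)
    then show "qbinom q n k *
        ((1 - e * q ^ n) * (B k * X k * E (n - k)) - (1 - \<beta>) * (B k * X (Suc k) * E (n - k))) =
      qbinom q n k *
        (q ^ k * (B k * X k * E (Suc n - k)) + B (Suc k) * X (Suc k) * E (Suc n - Suc k))"
      by (simp only:)
  qed
  also have "\<dots> = (\<Sum>k\<le>Suc n. qbinom q (Suc n) k * (B k * X k * E (Suc n - k)))"
    by (rule sum_qbinom_Suc[OF assms(2), symmetric])
  finally show ?case by (simp only: B_def X_def E_def)
qed

text \<open>
  In the rearranged sum the first product is at most a constant times \<open>(R/2) ^ k\<close>, since it decays
  faster than any geometric sequence, and the last one at most a constant times \<open>R ^ (n - k)\<close>. The
  choice of \<open>R/2\<close> makes the sum over \<open>k\<close> a convergent geometric one.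
\<close>

theorem phi32_poly_growth:
  assumes q: "q \<noteq> 0" "norm q < 1" and de: "norm d < 1" "norm e < 1" and R: "norm x < R"
  obtains C where "C \<ge> 0" "\<And>n. norm (phi32_poly q n (\<alpha> * q ^ n) x d e) \<le> C * R ^ n"
proof -
  have R0: "R > 0" using R norm_ge_zero[of x] by linarith
  have neq: "d * q ^ k \<noteq> 1" "e * q ^ k \<noteq> 1" for k
    using mult_power_neq_1 q de by blast+
  define I where "I t = exp (t / (1 - t) / (1 - norm q))" for t
  define P where "P t = exp (t / (1 - norm q))" for t
  define K where "K = P (norm q) * I (norm q) * I (norm q)"
  define L where "L = P ((norm \<alpha> + norm d) / (R / 2)) * (P (norm x) * I (norm d)) * P (norm e / R)"
  have nonneg: "0 \<le> I t" "0 \<le> P t" for t by (auto simp: I_def P_def)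
  then have KL: "0 \<le> K" "0 \<le> L" by (auto simp: K_def L_def)
  have qb: "norm (qbinom q n k) \<le> K" for n k
  proof (cases "k \<le> n")
    case True
    have "norm (qbinom q n k) = norm (qpoch q q n) * norm (inverse (qpoch q q k)) *
        norm (inverse (qpoch q q (n - k)))"
      using True by (simp add: qbinom_def norm_mult norm_divide norm_inverse field_simps)
    also have "\<dots> \<le> K"
      unfolding K_def I_def P_def using q
      by (intro mult_mono norm_qpoch_le norm_inverse_qpoch_le) auto
    finally show ?thesis .
  qed (use KL in \<open>auto simp: qbinom_def\<close>)
  have summand: "norm ((\<Prod>j<k. \<alpha> * q ^ n - d * q ^ j) * (qpoch x q k / qpoch d q k) *
                   (\<Prod>j<n-k. x - e * q ^ j)) \<le> L * (R ^ n * (1 / 2) ^ k)" if "k \<le> n" for n k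
  proof -
    have "norm (\<Prod>j<k. \<alpha> * q ^ n - d * q ^ j) \<le> (R / 2) ^ k * P ((norm \<alpha> + norm d) / (R / 2))"
      unfolding P_def
    proof (rule norm_prod_le_power)
      fix j assume "j < k"
      then have "norm q ^ n \<le> norm q ^ j"
        using that q by (intro power_decreasing) auto
      then have "norm \<alpha> * norm q ^ n + norm d * norm q ^ j \<le> (norm \<alpha> + norm d) * norm q ^ j"
        by (simp add: distrib_right mult_left_mono)
      moreover have "norm (\<alpha> * q ^ n - d * q ^ j) \<le> norm \<alpha> * norm q ^ n + norm d * norm q ^ j"
        using norm_triangle_ineq4[of "\<alpha> * q ^ n" "d * q ^ j"] by (simp add: norm_mult norm_power)
      ultimately show "norm (\<alpha> * q ^ n - d * q ^ j) \<le> R / 2 + (norm \<alpha> + norm d) * norm q ^ j"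
        using R0 by linarith
    qed (use q R0 in auto)
    moreover have "norm (qpoch x q k / qpoch d q k) \<le> P (norm x) * I (norm d)"
      unfolding divide_inverse[of "qpoch x q k"] norm_mult P_def I_def using q de
      by (intro mult_mono norm_qpoch_le norm_inverse_qpoch_le) auto
    moreover have "norm (\<Prod>j<n-k. x - e * q ^ j) \<le> R ^ (n - k) * P (norm e / R)"
      unfolding P_def
    proof (rule norm_prod_le_power)
      fix j
      have "norm (x - e * q ^ j) \<le> norm x + norm e * norm q ^ j"
        using norm_triangle_ineq4[of x "e * q ^ j"] by (simp add: norm_mult norm_power)
      then show "norm (x - e * q ^ j) \<le> R + norm e * norm q ^ j" using R by linarith
    qed (use q R0 in auto)
    ultimately have "norm ((\<Prod>j<k. \<alpha> * q ^ n - d * q ^ j) * (qpoch x q k / qpoch d q k) *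
                   (\<Prod>j<n-k. x - e * q ^ j)) \<le>
        ((R / 2) ^ k * P ((norm \<alpha> + norm d) / (R / 2))) * (P (norm x) * I (norm d)) *
        (R ^ (n - k) * P (norm e / R))"
      unfolding norm_mult using nonneg R0 by (intro mult_mono) auto
    also have "\<dots> = L * ((R ^ k * R ^ (n - k)) * (1 / 2) ^ k)"
      by (simp add: L_def power_divide)
    also have "R ^ k * R ^ (n - k) = R ^ n"
      using that by (simp add: power_add[symmetric])
    finally show ?thesis .
  qed
  have "norm (phi32_poly q n (\<alpha> * q ^ n) x d e) \<le> I (norm e) * K * L * 2 * R ^ n" for n
  proof -
    have "qpoch e q n \<noteq> 0" using qpoch_nonzero q de by blast
    then have "phi32_poly q n (\<alpha> * q ^ n) x d e = inverse (qpoch e q n) *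
        (\<Sum>k\<le>n. qbinom q n k * ((\<Prod>j<k. \<alpha> * q ^ n - d * q ^ j) * (qpoch x q k / qpoch d q k) *
                              (\<Prod>j<n-k. x - e * q ^ j)))"
      unfolding phi32_poly_convolution[OF q neq, symmetric] by simp
    also have "norm \<dots> \<le> I (norm e) * (\<Sum>k\<le>n. K * (L * (R ^ n * (1 / 2) ^ k)))"
      unfolding norm_mult
    proof (rule mult_mono)
      show "norm (inverse (qpoch e q n)) \<le> I (norm e)"
        unfolding I_def using q de by (intro norm_inverse_qpoch_le) auto
      show "norm (\<Sum>k\<le>n. qbinom q n k * ((\<Prod>j<k. \<alpha> * q ^ n - d * q ^ j) *
          (qpoch x q k / qpoch d q k) * (\<Prod>j<n-k. x - e * q ^ j))) \<le>
          (\<Sum>k\<le>n. K * (L * (R ^ n * (1 / 2) ^ k)))"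
        by (rule order.trans[OF norm_sum], rule sum_mono, subst norm_mult, rule mult_mono)
           (use qb summand KL in auto)
    qed (use nonneg in auto)
    also have "\<dots> = I (norm e) * K * L * R ^ n * (\<Sum>k\<le>n. (1 / 2) ^ k)"
      by (simp add: sum_distrib_left mult_ac)
    also have "(\<Sum>k\<le>n. (1 / 2 :: real) ^ k) = 2 - (1 / 2) ^ n"
      by (induction n) simp_all
    also have "I (norm e) * K * L * R ^ n * \<dots> \<le> I (norm e) * K * L * R ^ n * 2"
      using nonneg KL R0 by (intro mult_left_mono) auto
    finally show ?thesis by (simp only: mult_ac)
  qed
  then show ?thesis using that[of "I (norm e) * K * L * 2"] nonneg KL by auto
qed

section \<open>The identity at the powers of q\<close>

text \<open>
  The powers of \<open>q\<close> cancel: the two products contribute \<open>q ^ j\<close> and \<open>q ^ (j - N)\<close> for \<open>j < N\<close>, of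
  total exponent \<open>(\<Sum>j<N. 2 * j - N) = - N\<close>, and their signs agree.
\<close>

lemma prod_power_diff_mult_qpoch_inverse_power:
  assumes "q \<noteq> 0"
  shows "(\<Prod>j<N. q ^ N - q ^ j) * qpoch (inverse q ^ N) q N * q ^ N = qpoch q q N ^ 2"
proof -
  have w: "(\<Prod>j<N. q ^ N - q ^ j) = (\<Prod>j<N. - (q ^ j) * (1 - q ^ (N - j)))"
    by (intro prod.cong) (auto simp: algebra_simps power_add[symmetric])
  have p: "qpoch (inverse q ^ N) q N = (\<Prod>j<N. - (inverse q ^ (N - j)) * (1 - q ^ (N - j)))"
    unfolding qpoch_def
  proof (rule prod.cong[OF refl])
    fix j assume "j \<in> {..<N}"
    then have "N = (N - j) + j" by simp
    then have "inverse q ^ N = inverse q ^ (N - j) * inverse q ^ j"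
      by (metis power_add)
    then show "1 - inverse q ^ N * q ^ j = - (inverse q ^ (N - j)) * (1 - q ^ (N - j))"
      using assms by (simp add: algebra_simps power_mult_distrib[symmetric] flip: power_inverse)
  qed
  have r: "(\<Prod>j<N. f (N - j)) = (\<Prod>j<N. f (Suc j))" for f :: "nat \<Rightarrow> complex"
    by (subst prod.nat_diff_reindex[symmetric]) (auto intro!: prod.cong simp: Suc_diff_Suc)
  have qp: "qpoch q q N = (\<Prod>j<N. 1 - q ^ (N - j))"
    unfolding qpoch_def r[of "\<lambda>i. 1 - q ^ i"] by simp
  have "(\<Prod>j<N. q ^ j) * (\<Prod>j<N. inverse q ^ (N - j)) * q ^ N = 1"
    unfolding r[of "\<lambda>i. inverse q ^ i"] prod.distrib[symmetric]
    using assms by (simp add: power_mult_distrib[symmetric] prod_constant mult_ac)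
  then show ?thesis
    unfolding w p qp prod.distrib power2_eq_square
    by (simp add: prod_uminus mult_ac power_mult_distrib[symmetric])
qed

text \<open>
  This evaluates the partial sums of the coefficient of \<open>(x;q)\<^sub>k\<close> in the series for general \<open>s\<close>. In
  the notation \<open>y = q ^ (p+1)\<close>, \<open>w = q ^ k\<close> the induction step amounts to
  \<open>(w - y) (1 - \<alpha> y s) + (1 - \<alpha> y\<^sup>2) (s - w) = (1 - \<alpha> y w) (s - y)\<close>. Behind it is the very-well-poised
  \<open>\<^sub>6\<phi>\<^sub>5\<close> sum, here in a degenerate case where indefinite summation is possible.
\<close>

lemma sum_node_qpoch_telescope:
  assumes q: "q \<noteq> 0" "norm q < 1" and s: "\<And>k. \<alpha> * q * s * q ^ k \<noteq> 1"
  shows "(\<Sum>n\<le>p. (\<Prod>j<n. s - q ^ j) * qpoch \<alpha> q n * (1 - \<alpha> * q ^ (2 * n)) /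
             (qpoch (\<alpha> * q * s) q n * qpoch q q n) *
             (qpoch (inverse q ^ n) q k * qpoch (\<alpha> * q ^ n) q k)) * (s - q ^ k) =
         (1 - \<alpha>) * ((\<Prod>j<Suc p. s - q ^ j) * qpoch (\<alpha> * q) q p /
             (qpoch (\<alpha> * q * s) q p * qpoch q q p) *
             (qpoch (inverse q ^ p) q k * qpoch (\<alpha> * q ^ Suc p) q k))"
proof (induction p)
  case 0
  show ?case
  proof (cases k)
    case (Suc m)
    then have "qpoch 1 q k = 0" by (simp add: qpoch_Suc_left)
    then show ?thesis by simp
  qed simp
next
  case (Suc p)
  define W where "W = (\<Prod>j<Suc p. s - q ^ j)"
  define A where "A = qpoch (\<alpha> * q) q p"
  define D where "D = qpoch (\<alpha> * q * s) q p"
  define Q where "Q = qpoch q q p"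
  define U where "U = qpoch (inverse q ^ Suc p) q k"
  define V where "V = qpoch (\<alpha> * q ^ Suc p) q k"
  define y where "y = q ^ Suc p"
  define w where "w = q ^ k"
  have D: "D \<noteq> 0" unfolding D_def qpoch_eq_0_iff using s by blast
  have Ds: "1 - \<alpha> * y * s \<noteq> 0" using s[of p] by (simp add: y_def mult_ac)
  have Q: "Q \<noteq> 0" unfolding Q_def using qpoch_nonzero q by blast
  have y: "1 - y \<noteq> 0" using mult_power_neq_1[of q q p] q by (simp add: y_def)
  have y0: "y \<noteq> 0" using q by (simp add: y_def)
  \<comment> \<open>moving from \<open>p\<close> to \<open>p + 1\<close> changes each of the two factorials of length \<open>k\<close> by its first and last
      factor only\<close>
  have U': "qpoch (inverse q ^ p) q k = U * (w - y) / (1 - y)"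
  proof -
    have a: "inverse q ^ Suc p = inverse y" and b: "inverse q ^ p = inverse y * q"
      using q by (simp_all add: y_def power_inverse)
    have "U * (1 - inverse y * w) = (1 - inverse y) * qpoch (inverse q ^ p) q k"
      unfolding U_def a b w_def by (rule trans[OF qpoch_Suc[symmetric] qpoch_Suc_left])
    then show ?thesis using y y0 by (simp add: field_simps)
  qed
  have V': "V * (1 - \<alpha> * y * w) = (1 - \<alpha> * y) * qpoch (\<alpha> * q ^ Suc (Suc p)) q k"
    using qpoch_Suc[of "\<alpha> * q ^ Suc p" q k] qpoch_Suc_left[of "\<alpha> * q ^ Suc p" q k]
    unfolding V_def y_def w_def by (simp add: mult_ac)
  have alpha: "qpoch \<alpha> q (Suc p) = (1 - \<alpha>) * A"
    by (simp add: qpoch_Suc_left A_def)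
  have y2: "q ^ (2 * Suc p) = y * y"
    unfolding y_def by (simp only: mult_2 power_add)
  have sQ: "qpoch q q (Suc p) = Q * (1 - y)" by (simp add: Q_def qpoch_Suc y_def)
  have sD: "qpoch (\<alpha> * q * s) q (Suc p) = D * (1 - \<alpha> * y * s)"
    by (simp add: D_def qpoch_Suc y_def mult_ac)
  have sA: "qpoch (\<alpha> * q) q (Suc p) = A * (1 - \<alpha> * y)"
    by (simp add: A_def qpoch_Suc y_def mult_ac)
  have sW: "(\<Prod>j<Suc (Suc p). s - q ^ j) = W * (s - y)"
    by (simp add: W_def y_def)
  let ?c = "(1 - \<alpha>) * (W * A * U / (D * (1 - \<alpha> * y * s) * Q * (1 - y)))"
  have "(1 - \<alpha>) * (W * A / (D * Q) * (U * (w - y) / (1 - y) * V)) +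
        W * ((1 - \<alpha>) * A) * (1 - \<alpha> * (y * y)) / (D * (1 - \<alpha> * y * s) * (Q * (1 - y))) * (U * V)
          * (s - w) =
        ?c * (V * ((w - y) * (1 - \<alpha> * y * s) + (1 - \<alpha> * (y * y)) * (s - w)))"
    using D Ds Q y by (simp add: divide_simps) (simp add: algebra_simps)
  also have "(w - y) * (1 - \<alpha> * y * s) + (1 - \<alpha> * (y * y)) * (s - w) =
        (1 - \<alpha> * y * w) * (s - y)"
    by (simp add: algebra_simps)
  also have "?c * (V * ((1 - \<alpha> * y * w) * (s - y))) =
             ?c * ((1 - \<alpha> * y) * qpoch (\<alpha> * q ^ Suc (Suc p)) q k * (s - y))"
    unfolding V'[symmetric] by (simp only: mult.assoc)
  also have "\<dots> = (1 - \<alpha>) * (W * (s - y) * (A * (1 - \<alpha> * y)) /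
      (D * (1 - \<alpha> * y * s) * (Q * (1 - y))) * (U * qpoch (\<alpha> * q ^ Suc (Suc p)) q k))"
    by (simp add: mult_ac)
  finally show ?case
    unfolding sum.atMost_Suc distrib_right Suc.IH
    unfolding U' alpha y2 sQ sD sA sW
    unfolding W_def[symmetric] A_def[symmetric] D_def[symmetric] Q_def[symmetric]
      U_def[symmetric] V_def[symmetric] w_def[symmetric] .
qed

text \<open>
  The summand of the theorem with \<open>s ^ n (1/s;q)\<^sub>n\<close> written as a polynomial in \<open>s\<close>, so that it makes
  sense and is holomorphic at \<open>s = 0\<close>.
\<close>

definition qHahn_term ::
  "complex \<Rightarrow> complex \<Rightarrow> complex \<Rightarrow> complex \<Rightarrow> complex \<Rightarrow> nat \<Rightarrow> complex \<Rightarrow> complex" where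
  "qHahn_term q \<alpha> x d e n s =
     (\<Prod>j<n. s - q ^ j) * qpoch \<alpha> q n * (1 - \<alpha> * q ^ (2 * n)) /
       (qpoch (\<alpha> * q * s) q n * qpoch q q n) / (1 - \<alpha>) * phi32_poly q n (\<alpha> * q ^ n) x d e"

text \<open>
  The factor \<open>\<Prod>j<n. s - q ^ j\<close> ends the series after \<open>n = N\<close>. Expanding the terminating \<open>\<^sub>3\<phi>\<^sub>2\<close> in \<open>k\<close>
  and summing over \<open>n\<close> first gives zero for \<open>k < N\<close>, by telescoping; for \<open>k = N\<close> only \<open>n = N\<close>
  contributes, because \<open>(q^{-n};q)\<^sub>N = 0\<close> for \<open>n < N\<close>.
\<close>

lemma qHahn_term_sums_power:
  assumes q: "q \<noteq> 0" "norm q < 1" and \<alpha>: "\<alpha> \<noteq> 1" and N: "norm (\<alpha> * q * q ^ N) < 1"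
  shows "(\<lambda>n. qHahn_term q \<alpha> x d e n (q ^ N)) sums
           (qpoch (\<alpha> * q) q N * qpoch x q N / (qpoch d q N * qpoch e q N))"
proof -
  define c where "c k = qpoch x q k / (qpoch q q k * qpoch d q k * qpoch e q k) * q ^ k" for k
  define h where "h n = (\<Prod>j<n. q ^ N - q ^ j) * qpoch \<alpha> q n * (1 - \<alpha> * q ^ (2 * n)) /
             (qpoch (\<alpha> * q * q ^ N) q n * qpoch q q n)" for n
  define g where "g n k = h n * (qpoch (inverse q ^ n) q k * qpoch (\<alpha> * q ^ n) q k)" for n k
  have s: "\<alpha> * q * q ^ N * q ^ k \<noteq> 1" for k
    using mult_power_neq_1[OF q(2) N] .
  have nz: "qpoch q q m \<noteq> 0" for m using qpoch_nonzero q by blast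
  have gen: "qHahn_term q \<alpha> x d e n (q ^ N) = (\<Sum>k\<le>N. g n k * c k) / (1 - \<alpha>)" if "n \<le> N" for n
    unfolding qHahn_term_def phi32_poly_upto[OF q(1) that] g_def c_def h_def
    by (simp add: sum_distrib_left sum_divide_distrib mult_ac)
  have zero: "(\<Sum>n\<le>N. g n k) = 0" if "k < N" for k
  proof -
    have "(\<Prod>j<Suc N. q ^ N - q ^ j) = 0" by simp
    then have "(\<Sum>n\<le>N. g n k) * (q ^ N - q ^ k) = 0"
      unfolding g_def h_def sum_node_qpoch_telescope[OF q s] by simp
    moreover have "q ^ N \<noteq> q ^ k"
    proof
      assume "q ^ N = q ^ k"
      moreover have "q ^ N = q ^ k * (q * q ^ (N - Suc k))"
        using that by (simp flip: power_Suc power_add)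
      ultimately have "q * q ^ (N - Suc k) = 1" using q by simp
      then show False using mult_power_neq_1 q by blast
    qed
    ultimately show ?thesis by simp
  qed
  have last: "(\<Sum>n\<le>N. g n N) * c N / (1 - \<alpha>) =
      qpoch (\<alpha> * q) q N * qpoch x q N / (qpoch d q N * qpoch e q N)"
  proof -
    have gN: "(\<Sum>n\<le>N. g n N) = g N N"
      by (rule sum.remove[THEN trans, of _ N], simp, simp)
         (auto intro!: sum.neutral simp: g_def qpoch_inverse_power_eq_0[OF q(1)])
    \<comment> \<open>both sides are \<open>(\<alpha>;q)\<close> with \<open>2 N + 1\<close> factors, split in two ways\<close>
    have A: "qpoch \<alpha> q N * qpoch (\<alpha> * q ^ N) q N * (1 - \<alpha> * q ^ (2 * N)) =
          (1 - \<alpha>) * qpoch (\<alpha> * q) q N * qpoch (\<alpha> * q * q ^ N) q N"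
    proof -
      have "qpoch \<alpha> q N * qpoch (\<alpha> * q ^ N) q N * (1 - \<alpha> * q ^ (2 * N)) = qpoch \<alpha> q (Suc (N + N))"
        unfolding qpoch_Suc qpoch_add by (simp add: mult_2)
      also have "\<dots> = (1 - \<alpha>) * (qpoch (\<alpha> * q) q N * qpoch (\<alpha> * q * q ^ N) q N)"
        unfolding qpoch_Suc_left qpoch_add ..
      finally show ?thesis by (simp only: mult.assoc)
    qed
    have nz': "qpoch (\<alpha> * q * q ^ N) q N \<noteq> 0"
      using s by (auto simp: qpoch_eq_0_iff)
    have "g N N * c N = (qpoch \<alpha> q N * qpoch (\<alpha> * q ^ N) q N * (1 - \<alpha> * q ^ (2 * N))) *
        ((\<Prod>j<N. q ^ N - q ^ j) * qpoch (inverse q ^ N) q N * q ^ N) * qpoch x q N /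
        (qpoch (\<alpha> * q * q ^ N) q N * (qpoch q q N ^ 2 * qpoch d q N * qpoch e q N))"
      unfolding g_def h_def c_def
      by (simp only: times_divide_eq_left times_divide_eq_right times_divide_times_eq divide_divide_eq_left divide_divide_eq_right power2_eq_square mult_ac)
    also have "\<dots> = (1 - \<alpha>) * qpoch (\<alpha> * q) q N *
        ((\<Prod>j<N. q ^ N - q ^ j) * qpoch (inverse q ^ N) q N * q ^ N) * qpoch x q N /
        (qpoch q q N ^ 2 * qpoch d q N * qpoch e q N)"
      unfolding A using nz' by (simp add: mult_ac)
    finally have "(\<Sum>n\<le>N. g n N) * c N = \<dots>"
      unfolding gN .
    then show ?thesis
      unfolding prod_power_diff_mult_qpoch_inverse_power[OF q(1)] using \<alpha> nz by simp
  qed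
  have "(\<Sum>n\<le>N. qHahn_term q \<alpha> x d e n (q ^ N)) = (\<Sum>k\<le>N. (\<Sum>n\<le>N. g n k) * c k) / (1 - \<alpha>)"
    by (simp add: gen sum_divide_distrib[symmetric] sum_distrib_right)
       (subst sum.swap, simp)
  also have "(\<Sum>k\<le>N. (\<Sum>n\<le>N. g n k) * c k) = (\<Sum>n\<le>N. g n N) * c N"
    by (rule sum.remove[THEN trans, of _ N], simp, simp)
       (auto intro!: sum.neutral simp: zero)
  finally have "(\<Sum>n\<le>N. qHahn_term q \<alpha> x d e n (q ^ N)) =
      qpoch (\<alpha> * q) q N * qpoch x q N / (qpoch d q N * qpoch e q N)"
    unfolding last .
  moreover have "qHahn_term q \<alpha> x d e n (q ^ N) = 0" if "n \<notin> {..N}" for n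
  proof -
    have "(\<Prod>j<n. q ^ N - q ^ j) = 0" using that by (auto simp: not_le)
    then show ?thesis by (simp add: qHahn_term_def)
  qed
  ultimately show ?thesis
    using sums_finite[of "{..N}" "\<lambda>n. qHahn_term q \<alpha> x d e n (q ^ N)"] by simp
qed

section \<open>Analytic continuation in s\<close>

lemma qHahn_term_bound:
  assumes q: "q \<noteq> 0" "norm q < 1" and de: "norm d < 1" "norm e < 1"
    and \<rho>: "0 < \<rho>" "\<rho> * norm x < 1" "\<rho> * norm (\<alpha> * q) < 1"
  obtains C r where "0 \<le> r" "r < 1"
    "\<And>n s. norm s \<le> \<rho> \<Longrightarrow> norm (qHahn_term q \<alpha> x d e n s) \<le> C * r ^ n"
proof -
  obtain R where R: "norm x < R" "\<rho> * R < 1"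
  proof -
    have "norm x < 1 / \<rho>" using \<rho> by (simp add: field_simps)
    then obtain R where "norm x < R" "R < 1 / \<rho>" using dense by blast
    then show ?thesis using that[of R] \<rho> by (simp add: field_simps)
  qed
  have R0: "0 \<le> R" using R norm_ge_zero[of x] by linarith
  obtain F where F: "F \<ge> 0" "\<And>n. norm (phi32_poly q n (\<alpha> * q ^ n) x d e) \<le> F * R ^ n"
    using phi32_poly_growth[OF q de R(1), of \<alpha>] by blast
  define t where "t = \<rho> * norm (\<alpha> * q)"
  define I where "I u = exp (u / (1 - u) / (1 - norm q))" for u
  define P where "P u = exp (u / (1 - norm q))" for u
  have nonneg: "0 \<le> I u" "0 \<le> P u" for u by (auto simp: I_def P_def)
  define C where "C = P (1 / \<rho>) * P (norm \<alpha>) * (1 + norm \<alpha>) * I t * I (norm q) *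
                      norm (inverse (1 - \<alpha>)) * F"
  have "norm (qHahn_term q \<alpha> x d e n s) \<le> C * (\<rho> * R) ^ n" if s: "norm s \<le> \<rho>" for n s
  proof -
    have "norm (\<Prod>j<n. s - q ^ j) \<le> \<rho> ^ n * P (1 / \<rho>)"
      unfolding P_def
    proof (rule norm_prod_le_power)
      fix j
      show "norm (s - q ^ j) \<le> \<rho> + 1 * norm q ^ j"
        using norm_triangle_ineq4[of s "q ^ j"] s by (simp add: norm_power)
    qed (use q \<rho> in auto)
    moreover have "norm (qpoch \<alpha> q n) \<le> P (norm \<alpha>)"
      unfolding P_def using q by (intro norm_qpoch_le)
    moreover have "norm (1 - \<alpha> * q ^ (2 * n)) \<le> 1 + norm \<alpha>"
    proof -
      have "norm (\<alpha> * q ^ (2 * n)) \<le> norm \<alpha> * 1"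
        unfolding norm_mult norm_power using q by (intro mult_left_mono power_le_one) auto
      then show ?thesis using norm_triangle_ineq4[of 1 "\<alpha> * q ^ (2 * n)"] by simp
    qed
    moreover have "norm (inverse (qpoch (\<alpha> * q * s) q n)) \<le> I t"
      unfolding I_def
    proof (rule norm_inverse_qpoch_le)
      show "norm (\<alpha> * q * s) \<le> t"
        unfolding t_def norm_mult[of _ s] using s by (simp add: mult.commute mult_right_mono)
    qed (use q \<rho> in \<open>auto simp: t_def\<close>)
    moreover have "norm (inverse (qpoch q q n)) \<le> I (norm q)"
      unfolding I_def using q by (intro norm_inverse_qpoch_le) auto
    ultimately have "norm (\<Prod>j<n. s - q ^ j) * norm (qpoch \<alpha> q n) * norm (1 - \<alpha> * q ^ (2 * n)) *
          norm (inverse (qpoch (\<alpha> * q * s) q n)) * norm (inverse (qpoch q q n)) *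
          norm (inverse (1 - \<alpha>)) * norm (phi32_poly q n (\<alpha> * q ^ n) x d e) \<le>
        (\<rho> ^ n * P (1 / \<rho>)) * P (norm \<alpha>) * (1 + norm \<alpha>) * I t * I (norm q) *
          norm (inverse (1 - \<alpha>)) * (F * R ^ n)"
      using nonneg \<rho> F by (intro mult_mono) (auto intro!: mult_nonneg_nonneg)
    moreover have "qHahn_term q \<alpha> x d e n s = (\<Prod>j<n. s - q ^ j) * qpoch \<alpha> q n * (1 - \<alpha> * q ^ (2 * n)) *
          inverse (qpoch (\<alpha> * q * s) q n) * inverse (qpoch q q n) *
          inverse (1 - \<alpha>) * phi32_poly q n (\<alpha> * q ^ n) x d e"
      by (simp add: qHahn_term_def divide_inverse)
    ultimately show ?thesis
      by (simp only: norm_mult C_def power_mult_distrib mult_ac)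
  qed
  then show ?thesis using that[of "\<rho> * R" C] \<rho> R R0 by simp
qed

lemma convergent_prod_qpoch:
  fixes q y :: complex
  assumes "norm q < 1"
  shows "convergent_prod (\<lambda>k. 1 - y * q ^ k)"
proof -
  have "summable (\<lambda>k. norm y * norm q ^ k)"
    using assms by (intro summable_mult summable_geometric) auto
  then have "summable (\<lambda>k. norm ((1 - y * q ^ k) - 1))"
    by (simp add: norm_mult norm_power)
  then show ?thesis
    by (intro abs_convergent_prod_imp_convergent_prod summable_imp_abs_convergent_prod)
qed

lemma qpoch_LIMSEQ:
  assumes "norm q < 1"
  shows "(\<lambda>n. qpoch y q n) \<longlonglongrightarrow> qpoch_inf y q"
  using convergent_prod_LIMSEQ[OF convergent_prod_qpoch[OF assms, of y]]
  unfolding qpoch_def qpoch_inf_def LIMSEQ_lessThan_iff_atMost .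

lemma qpoch_inf_nonzero:
  assumes "norm q < 1" "norm y < 1"
  shows "qpoch_inf y q \<noteq> 0"
  unfolding qpoch_inf_def
  by (rule prodinf_nonzero[OF convergent_prod_qpoch])
     (use mult_power_neq_1[OF assms] assms in auto)

lemma qpoch_inf_split:
  assumes "norm q < 1"
  shows "qpoch_inf y q = qpoch y q N * qpoch_inf (y * q ^ N) q"
proof (rule LIMSEQ_unique)
  show "(\<lambda>n. qpoch y q (N + n)) \<longlonglongrightarrow> qpoch_inf y q"
    using LIMSEQ_ignore_initial_segment[OF qpoch_LIMSEQ[OF assms], of y N]
    by (simp add: add.commute)
  show "(\<lambda>n. qpoch y q (N + n)) \<longlonglongrightarrow> qpoch y q N * qpoch_inf (y * q ^ N) q"
    unfolding qpoch_add by (intro tendsto_intros qpoch_LIMSEQ assms)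
qed

text \<open>
  The partial products converge uniformly on compact sets by comparison with a geometric series.
\<close>

lemma holomorphic_qpoch_inf:
  assumes "norm q < 1"
  shows "(\<lambda>s. qpoch_inf (c * s) q) holomorphic_on S"
proof -
  have "(\<lambda>s. qpoch_inf (c * s) q) holomorphic_on UNIV"
  proof (rule holomorphic_uniform_sequence)
    show "(\<lambda>s. qpoch (c * s) q n) holomorphic_on UNIV" for n
      unfolding qpoch_def by (intro holomorphic_intros)
    fix z :: complex
    let ?A = "cball z 1"
    have "uniformly_convergent_on ?A (\<lambda>n s. \<Prod>k<n. 1 - (c * s) * q ^ k)"
    proof (rule uniformly_convergent_on_prod')
      show "uniformly_convergent_on ?A (\<lambda>n s. \<Sum>k<n. norm ((1 - (c * s) * q ^ k) - 1))"
      proof (rule Weierstrass_m_test')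
        fix k s assume "s \<in> ?A"
        then have "norm s \<le> norm z + 1"
          using norm_triangle_ineq2[of s z] by (simp add: dist_norm norm_minus_commute)
        then show "norm (norm ((1 - (c * s) * q ^ k) - 1)) \<le>
            norm c * (norm z + 1) * norm q ^ k"
          by (simp add: norm_mult norm_power mult_mono)
      next
        show "summable (\<lambda>k. norm c * (norm z + 1) * norm q ^ k)"
          using assms by (intro summable_mult summable_geometric) auto
      qed
    qed (auto intro!: continuous_intros)
    then obtain l where l: "uniform_limit ?A (\<lambda>n s. qpoch (c * s) q n) l sequentially"
      unfolding qpoch_def uniformly_convergent_on_def by blast
    have "l s = qpoch_inf (c * s) q" if "s \<in> ?A" for s
      using tendsto_uniform_limitI[OF l that] qpoch_LIMSEQ[OF assms] LIMSEQ_unique by blast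
    then have "uniform_limit ?A (\<lambda>n s. qpoch (c * s) q n) (\<lambda>s. qpoch_inf (c * s) q) sequentially"
      using l by (subst uniform_limit_cong'[where g = "\<lambda>n s. qpoch (c * s) q n" and i = l]) auto
    then show "\<exists>d>0. cball z d \<subseteq> UNIV \<and>
        uniform_limit (cball z d) (\<lambda>n s. qpoch (c * s) q n) (\<lambda>s. qpoch_inf (c * s) q) sequentially"
      by (intro exI[of _ 1]) auto
  qed auto
  then show ?thesis by (rule holomorphic_on_subset) auto
qed

text \<open>
  Both sides are holomorphic in \<open>s\<close> on a disc about \<open>0\<close> that contains the given point and on which
  \<open>\<bar>x s\<bar> < 1\<close> and \<open>\<bar>\<alpha> q s\<bar> < 1\<close>. They agree at all powers \<open>q ^ N\<close> in this disc, where the infinite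
  products on the right telescope to finite ones.
\<close>

theorem qHahn_term_sums:
  assumes q: "q \<noteq> 0" "norm q < 1" and de: "norm d < 1" "norm e < 1" and \<alpha>: "\<alpha> \<noteq> 1"
    and s: "norm (x * s) < 1" "norm (\<alpha> * q * s) < 1"
  shows "(\<lambda>n. qHahn_term q \<alpha> x d e n s) sums
           (qpoch_inf (\<alpha> * q) q * qpoch_inf (d * s) q * qpoch_inf (e * s) q * qpoch_inf x q /
            (qpoch_inf (\<alpha> * q * s) q * qpoch_inf d q * qpoch_inf e q * qpoch_inf (x * s) q))"
proof -
  obtain \<rho> where \<rho>: "norm s < \<rho>" "\<rho> * norm x < 1" "\<rho> * norm (\<alpha> * q) < 1"
  proof -
    define M where "M = max (norm x) (norm (\<alpha> * q))"
    have M: "norm s * M < 1" "0 \<le> M"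
      using s by (auto simp: M_def max_def norm_mult mult_ac)
    obtain \<rho> where r: "norm s < \<rho>" "\<rho> * M < 1"
    proof (cases "M = 0")
      case True
      then show ?thesis using that[of "norm s + 1"] by simp
    next
      case False
      then have "norm s < 1 / M" using M by (simp add: field_simps)
      then obtain \<rho> where "norm s < \<rho>" "\<rho> < 1 / M" using dense by blast
      then show ?thesis using that[of \<rho>] M False by (simp add: field_simps)
    qed
    then have "0 \<le> \<rho>" using norm_ge_zero[of s] by linarith
    then have "\<rho> * norm x \<le> \<rho> * M" "\<rho> * norm (\<alpha> * q) \<le> \<rho> * M"
      by (auto simp: M_def intro!: mult_left_mono)
    then show ?thesis using that[of \<rho>] r by linarith
  qed
  have \<rho>0: "0 < \<rho>" using \<rho>(1) norm_ge_zero[of s] by linarith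
  have small: "norm (y * u) < 1" if "u \<in> ball 0 \<rho>" "\<rho> * norm y < 1" for u y :: complex
  proof -
    have "norm (y * u) \<le> \<rho> * norm y"
      using that by (simp add: norm_mult mult.commute mult_right_mono)
    then show ?thesis using that by linarith
  qed
  obtain C r where Cr: "0 \<le> r" "r < 1"
      "\<And>n u. norm u \<le> \<rho> \<Longrightarrow> norm (qHahn_term q \<alpha> x d e n u) \<le> C * r ^ n"
    by (rule qHahn_term_bound[OF q de \<rho>0 \<rho>(2,3)]) (rule that)
  define f where "f u = (\<Sum>n. qHahn_term q \<alpha> x d e n u)" for u
  define g where "g u = qpoch_inf (\<alpha> * q) q * qpoch_inf (d * u) q * qpoch_inf (e * u) q * qpoch_inf x q /
            (qpoch_inf (\<alpha> * q * u) q * qpoch_inf d q * qpoch_inf e q * qpoch_inf (x * u) q)" for u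
  have summable_bound: "summable (\<lambda>n. C * r ^ n)"
    using Cr by (intro summable_mult summable_geometric) auto
  \<comment> \<open>the dominating series does not depend on the point of the disc, so it gives both
      convergence here and uniform convergence below\<close>
  have sums_f: "(\<lambda>n. qHahn_term q \<alpha> x d e n u) sums f u" if "u \<in> ball 0 \<rho>" for u
    unfolding f_def
    by (rule summable_sums, rule summable_comparison_test'[OF summable_bound, of 0])
       (use Cr(3) that in auto)
  have nz: "qpoch_inf (\<alpha> * q * u) q \<noteq> 0" "qpoch_inf (x * u) q \<noteq> 0" if "u \<in> ball 0 \<rho>" for u
    using qpoch_inf_nonzero[OF q(2) small[OF that \<rho>(3)]]
      qpoch_inf_nonzero[OF q(2) small[OF that \<rho>(2)]] by blast+
  have nz_de: "qpoch_inf d q \<noteq> 0" "qpoch_inf e q \<noteq> 0"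
    using qpoch_inf_nonzero[OF q(2)] de by blast+
  have holo_f: "f holomorphic_on ball 0 \<rho>"
  proof (rule holomorphic_uniform_sequence[OF open_ball])
    show "(\<lambda>u. \<Sum>i<n. qHahn_term q \<alpha> x d e i u) holomorphic_on ball 0 \<rho>" for n
    proof -
      have "qpoch (\<alpha> * q * u) q i \<noteq> 0" if "u \<in> ball 0 \<rho>" for u i
        using qpoch_nonzero[OF q(2) small[OF that \<rho>(3)]] .
      then have nz': "(\<Prod>k<i. 1 - \<alpha> * q * u * q ^ k) \<noteq> 0" if "u \<in> ball 0 \<rho>" for u i
        using that unfolding qpoch_def by blast
      have "qpoch q q i \<noteq> 0" for i using qpoch_nonzero q by blast
      then show ?thesis
        unfolding qHahn_term_def qpoch_def[of "_ * _ * _"]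
        using \<alpha> nz' by (intro holomorphic_intros) auto
    qed
    have "uniform_limit (ball 0 \<rho>) (\<lambda>n u. \<Sum>i<n. qHahn_term q \<alpha> x d e i u) f sequentially"
      unfolding f_def by (rule Weierstrass_m_test[OF _ summable_bound]) (use Cr(3) in auto)
    moreover fix u :: complex assume "u \<in> ball 0 \<rho>"
    then obtain \<delta> where "\<delta> > 0" "cball u \<delta> \<subseteq> ball 0 \<rho>"
      by (meson open_ball open_contains_cball)
    ultimately show "\<exists>\<delta>>0. cball u \<delta> \<subseteq> ball 0 \<rho> \<and>
        uniform_limit (cball u \<delta>) (\<lambda>n u. \<Sum>i<n. qHahn_term q \<alpha> x d e i u) f sequentially"
      using uniform_limit_on_subset by blast
  qed
  have holo_g: "g holomorphic_on ball 0 \<rho>"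
    unfolding g_def using nz nz_de
    by (intro holomorphic_intros holomorphic_qpoch_inf q) auto
  define U where "U = {q ^ N | N. q ^ N \<in> ball 0 \<rho>}"
  have eq: "f u - g u = 0" if "u \<in> U" for u
  proof -
    obtain N where N: "u = q ^ N" "q ^ N \<in> ball 0 \<rho>" using \<open>u \<in> U\<close> unfolding U_def by blast
    have "norm (\<alpha> * q * q ^ N) < 1" using small[OF N(2) \<rho>(3)] .
    then have "f u = qpoch (\<alpha> * q) q N * qpoch x q N / (qpoch d q N * qpoch e q N)"
      using qHahn_term_sums_power[OF q \<alpha>] sums_f[OF N(2)] sums_unique2 N(1) by blast
    moreover have "g u = qpoch (\<alpha> * q) q N * qpoch x q N / (qpoch d q N * qpoch e q N)"
    proof -
      note split = qpoch_inf_split[OF q(2), of _ N]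
      have nz1: "qpoch_inf (d * q ^ N) q \<noteq> 0" "qpoch_inf (e * q ^ N) q \<noteq> 0"
        using nz_de split[of d] split[of e] by auto
      have nz2: "qpoch_inf (\<alpha> * q * q ^ N) q \<noteq> 0" "qpoch_inf (x * q ^ N) q \<noteq> 0"
        using nz N by auto
      show ?thesis
        unfolding g_def N(1) split[of "\<alpha> * q"] split[of x] split[of d] split[of e]
        using nz1 nz2 by (simp add: mult_ac)
    qed
    ultimately show ?thesis by simp
  qed
  have "0 islimpt U"
  proof -
    have lim: "(\<lambda>N. q ^ N) \<longlonglongrightarrow> 0"
      using q by (intro LIMSEQ_power_zero) auto
    then have "\<forall>\<^sub>F N in sequentially. q ^ N \<in> ball 0 \<rho>"
      using \<rho>0 by (intro topological_tendstoD) auto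
    then obtain M where "\<And>N. N \<ge> M \<Longrightarrow> q ^ N \<in> ball 0 \<rho>"
      by (auto simp: eventually_sequentially)
    then have "\<forall>N. q ^ (N + M) \<in> U - {0}" using q by (auto simp: U_def)
    moreover have "(\<lambda>N. q ^ (N + M)) \<longlonglongrightarrow> 0" using lim by (rule LIMSEQ_ignore_initial_segment)
    ultimately show ?thesis unfolding islimpt_sequential
      by (intro exI[of _ "\<lambda>N. q ^ (N + M)"] conjI)
  qed
  then have "f s - g s = 0"
    by (rule analytic_continuation[of "\<lambda>u. f u - g u" "ball 0 \<rho>" U 0 s, rotated 5])
       (use eq holo_f holo_g \<rho> \<rho>0 in \<open>auto simp: U_def intro!: holomorphic_intros\<close>)
  then show ?thesis using sums_f[of s] \<rho> by (simp add: g_def)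
qed

theorem proposition3p1:
  fixes q a b c d s z :: complex
  assumes "q \<noteq> 0" and "norm q < 1"
    and "a \<noteq> 0" and "s \<noteq> 0" and "a * b * c * d * inverse q \<noteq> 1"
    and "Max {norm (a * c), norm (a * d), norm (a * s * z), norm (a * b * c * d * s)} < 1"
  shows "(\<lambda>n. s ^ n * qpoch (inverse s) q n / qpoch (a * b * c * d * s) q n
              * qHahn_coeff q n a b c d * qHahn q n a b c d z)
         sums (qpochs_inf [a * b * c * d, a * c * s, a * d * s, a * z] q /
               qpochs_inf [a * b * c * d * s, a * c, a * d, a * s * z] q)"
proof -
  define \<alpha> where "\<alpha> = a * b * c * d * inverse q"
  have \<alpha>q: "a * b * c * d = \<alpha> * q" using assms(1) by (simp add: \<alpha>_def)
  have small: "norm (a * c) < 1" "norm (a * d) < 1" "norm (a * z * s) < 1" "norm (\<alpha> * q * s) < 1"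
    using assms(6) unfolding \<alpha>q by (auto simp: mult_ac)
  have "s ^ n * qpoch (inverse s) q n / qpoch (a * b * c * d * s) q n
              * qHahn_coeff q n a b c d * qHahn q n a b c d z =
        qHahn_term q \<alpha> (a * z) (a * c) (a * d) n s" for n
  proof -
    have w: "s ^ n * qpoch (inverse s) q n = (\<Prod>j<n. s - q ^ j)"
    proof -
      have "s ^ n * qpoch (inverse s) q n = (\<Prod>j<n. s * (1 - inverse s * q ^ j))"
        by (simp add: qpoch_def prod.distrib)
      also have "\<dots> = (\<Prod>j<n. s - q ^ j)"
        using assms(4) by (intro prod.cong) (auto simp: algebra_simps)
      finally show ?thesis .
    qed
    have p1: "\<alpha> * q * q powi (2 * int n - 1) = \<alpha> * q ^ (2 * n)"
    proof -
      have "q * q powi (2 * int n - 1) = q powi (2 * int n)"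
        using assms(1) by (simp add: power_int_diff)
      also have "\<dots> = q ^ (2 * n)" by (metis of_nat_mult of_nat_numeral power_int_of_nat)
      finally show ?thesis by (simp add: mult.assoc)
    qed
    have p2: "\<alpha> * q * q powi (int n - 1) = \<alpha> * q ^ n"
      using assms(1) by (simp add: power_int_diff)
    have a: "\<alpha> * q * inverse q = \<alpha>" using assms(1) by simp
    have "qpoch (a * c) q n \<noteq> 0" "qpoch (a * d) q n \<noteq> 0"
      using qpoch_nonzero[OF assms(2)] small by blast+
    then show ?thesis
      unfolding w qHahn_coeff_def qHahn_def qHahn_term_def \<alpha>q p1 p2 a
        phi32_eq_phi32_poly[OF assms(1)] qpochs_def
      using assms(3) by (simp add: mult_ac)
  qed
  moreover have "\<alpha> \<noteq> 1" using assms(5) by (simp add: \<alpha>_def)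
  ultimately show ?thesis
    using qHahn_term_sums[OF assms(1,2) small(1,2) _ small(3,4)]
    unfolding \<alpha>q qpochs_inf_def by (simp add: mult_ac)
qed

end
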